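(* Let $\mathbb X\subset\mathbb R^n$ be a compact convex set with nonempty interior such that $(x-x^0)^\top f(x,\xi)>0$ for every realization $\xi\in\Omega$, every $x\notin\mathrm{int}(\mathbb X)$ and every $x^0\in\mathrm{int}(\mathbb X)$. Let $x^0\in\mathrm{int}(\mathbb X)$ be given, let $h(x,t)=(1-t)d(x,t)+t(x-x^0)$ on $\mathbb R^n\times[0,1]$, and let $H^{-1}=\{(x,t)\in\mathbb R^n\times[0,1] : h(x,t)=0\}$. Then $H^{-1}$ contains a connected subset $H_c^{-1}$ such that $(\mathbb X\times\{0\})\cap H_c^{-1}\neq\emptyset$ and $(\mathbb X\times\{1\})\cap H_c^{-1}\neq\emptyset$.
   Context: Setting. $\xi$ is a random parameter with realizations in $\Omega$; for each $\xi\in\Omega$, $f(\cdot,\xi):\mathbb R^n\to\mathbb R^n$ is continuously differentiable. Fix samples $\xi_1,\dots,\xi_N\in\Omega$ with $N\ge1$. Construction of $d$. Let $L$ be an integer with $1\le L\le N$, let $0<q_1<q_2<\dots<q_L=N$ be integers, and let $1=t_0>t_1>\dots>t_L=0$. For $\ell=1,\dots,L$ put $f^\ell(x)=\frac1{q_\ell}\sum_{i=1}^{q_\ell}f(x,\xi_i)$, and put $f^0(x)=0\in\mathbb R^n$ for all $x$. For $\ell=1,\dots,L$ and $t\in[t_\ell,t_{\ell-1}]$ let $$\theta_\ell(t)=\sin^2\!\left(\frac{t-t_{\ell-1}}{t_\ell-t_{\ell-1}}\cdot\frac{\pi}{2}\right),\qquad d^\ell(x,t)=(1-\theta_\ell(t))f^{\ell-1}(x)+\theta_\ell(t)f^\ell(x).$$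 Define $d:\mathbb R^n\times[0,1]\to\mathbb R^n$ by $d(x,t)=d^\ell(x,t)$ for $t\in[t_\ell,t_{\ell-1}]$ (the definitions agree at the common endpoints). *)

theory Defs
  imports "HOL-Analysis.Analysis"
begin

text \<open>Continuity of the derivative is taken with respect to the operator norm.\<close>

definition continuously_differentiable ::
    "('a::real_normed_vector \<Rightarrow> 'b::real_normed_vector) \<Rightarrow> bool" where
  "continuously_differentiable g \<longleftrightarrow>
     (\<exists>g' :: 'a \<Rightarrow> 'a \<Rightarrow>\<^sub>L 'b.
        (\<forall>x. (g has_derivative blinfun_apply (g' x)) (at x)) \<and> continuous_on UNIV g')"

definition level_avg ::
    "(real^'n \<Rightarrow> 'w \<Rightarrow> real^'n) \<Rightarrow> (nat \<Rightarrow> 'w) \<Rightarrow> (nat \<Rightarrow> nat) \<Rightarrow> nat \<Rightarrow> real^'n \<Rightarrow> real^'n" where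
  "level_avg f \<xi> q l x =
     (if l = 0 then 0 else (1 / real (q l)) *\<^sub>R (\<Sum>i = 1..q l. f x (\<xi> i)))"

definition level_weight :: "(nat \<Rightarrow> real) \<Rightarrow> nat \<Rightarrow> real \<Rightarrow> real" where
  "level_weight \<tau> l t = (sin ((t - \<tau> (l - 1)) / (\<tau> l - \<tau> (l - 1)) * (pi / 2)))\<^sup>2"

definition level_map ::
    "(real^'n \<Rightarrow> 'w \<Rightarrow> real^'n) \<Rightarrow> (nat \<Rightarrow> 'w) \<Rightarrow> (nat \<Rightarrow> nat) \<Rightarrow> (nat \<Rightarrow> real) \<Rightarrow>
     nat \<Rightarrow> real^'n \<Rightarrow> real \<Rightarrow> real^'n" where
  "level_map f \<xi> q \<tau> l x t =
     (1 - level_weight \<tau> l t) *\<^sub>R level_avg f \<xi> q (l - 1) x +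
     level_weight \<tau> l t *\<^sub>R level_avg f \<xi> q l x"

text \<open>
  The knots \<open>\<tau> 0 > \<tau> 1 > \<dots> > \<tau> L\<close> decrease in the level. At a common endpoint of two
  neighbouring intervals the definition selects the lower level; the lemma
  \<open>multilevel_map_eq\<close> below shows that this choice is immaterial. Only arguments
  \<open>t\<close> between \<open>\<tau> L\<close> and \<open>\<tau> 0\<close> are meaningful.
\<close>

definition multilevel_map ::
    "(real^'n \<Rightarrow> 'w \<Rightarrow> real^'n) \<Rightarrow> (nat \<Rightarrow> 'w) \<Rightarrow> (nat \<Rightarrow> nat) \<Rightarrow> (nat \<Rightarrow> real) \<Rightarrow>
     nat \<Rightarrow> real^'n \<Rightarrow> real \<Rightarrow> real^'n" where
  "multilevel_map f \<xi> q \<tau> L x t =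
     level_map f \<xi> q \<tau> (LEAST l. l \<in> {1..L} \<and> t \<in> {\<tau> l..\<tau> (l - 1)}) x t"

lemma multilevel_map_eq:
  assumes anti: "strict_antimono_on {0..L} \<tau>"
    and l: "l \<in> {1..L}" and t: "t \<in> {\<tau> l..\<tau> (l - 1)}"
  shows "multilevel_map f \<xi> q \<tau> L x t = level_map f \<xi> q \<tau> l x t"
proof -
  define m where "m = (LEAST l. l \<in> {1..L} \<and> t \<in> {\<tau> l..\<tau> (l - 1)})"
  have m: "m \<in> {1..L}" "t \<in> {\<tau> m..\<tau> (m - 1)}"
    using LeastI[of "\<lambda>l. l \<in> {1..L} \<and> t \<in> {\<tau> l..\<tau> (l - 1)}" l, folded m_def] l t by blast+
  have "m \<le> l"
    unfolding m_def using l t by (intro Least_le) auto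
  have less: "\<tau> j < \<tau> i" if "i < j" "j \<le> L" for i j
    using monotone_onD[OF anti, of i j] that by auto
  have eq: "level_map f \<xi> q \<tau> m x t = level_map f \<xi> q \<tau> l x t"
  proof (cases "m = l")
    case False
    with \<open>m \<le> l\<close> have "m < l" by simp
    have "m = l - 1"
    proof (rule ccontr)
      assume "m \<noteq> l - 1"
      then have "\<tau> (l - 1) < \<tau> m"
        using \<open>m < l\<close> l by (intro less) auto
      then show False using m t by auto
    qed
    then have tm: "t = \<tau> m" and lm: "l = Suc m" using m t \<open>m < l\<close> by auto
    have "\<tau> m \<noteq> \<tau> (m - 1)" using less[of "m - 1" m] m by auto
    then have "level_weight \<tau> m t = 1" "level_weight \<tau> l t = 0"
      by (simp_all add: level_weight_def tm lm)
    then show ?thesis by (simp add: level_map_def lm)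
  qed simp
  then show ?thesis by (simp add: multilevel_map_def m_def)
qed

definition homotopy_map :: "(real^'n \<Rightarrow> real \<Rightarrow> real^'n) \<Rightarrow> real^'n \<Rightarrow> real^'n \<Rightarrow> real \<Rightarrow> real^'n" where
  "homotopy_map d x0 x t = (1 - t) *\<^sub>R d x t + t *\<^sub>R (x - x0)"

definition homotopy_zeros :: "(real^'n \<Rightarrow> real \<Rightarrow> real^'n) \<Rightarrow> ((real^'n) \<times> real) set" where
  "homotopy_zeros h = {(x, t) \<in> UNIV \<times> {0..1}. h x t = 0}"

end

theory Submission
  imports Defs
begin

text \<open>
  Off the interior of \<open>X\<close> the homotopy satisfies \<open>(x - x0) \<bullet> h x t > 0\<close>. Hence the fixed points of
  \<open>x \<mapsto> closest_point X (x - h x t)\<close> are zeros of \<open>h\<close>, and it suffices to find a continuum of fixed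
  points of a homotopy \<open>F\<close> of self-maps of \<open>X\<close> joining the two ends (Browder's theorem). If there
  were none, the fixed point set would split into disjoint closed sets \<open>A\<close> and \<open>B\<close> containing
  its ends \<open>t = 0\<close> and \<open>t = 1\<close>. With a continuous \<open>u\<close> equal to 1 on \<open>A\<close> and 0 on \<open>B\<close>, the map
  \<open>(x, t) \<mapsto> (F (x, t), u (x, t))\<close> would contradict Brouwer's theorem on \<open>X \<times> [0, 1]\<close>.
\<close>

section \<open>Continua of fixed points and of zeros\<close>

theorem connected_fixed_points_homotopy:
  fixes F :: "'a::euclidean_space \<times> real \<Rightarrow> 'a"
  assumes S: "compact S" "convex S" "S \<noteq> {}"
    and contF: "continuous_on (S \<times> {0..1}) F"
    and F: "F \<in> S \<times> {0..1} \<rightarrow> S"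
  obtains C where "C \<subseteq> {p \<in> S \<times> {0..1}. F p = fst p}" "connected C"
    "C \<inter> S \<times> {0} \<noteq> {}" "C \<inter> S \<times> {1} \<noteq> {}"
proof -
  define K where "K = {p \<in> S \<times> {0..1}. F p = fst p}"
  have cpt: "compact (S \<times> {0..1::real})"
    using S by (intro compact_Times) auto
  have "closed K"
    using continuous_closed_preimage_constant[of "S \<times> {0..1}" "\<lambda>p. F p - fst p" 0] contF cpt
    by (simp add: K_def compact_imp_closed continuous_intros)
  moreover have "K \<subseteq> S \<times> {0..1}"
    by (auto simp: K_def)
  ultimately have "compact K"
    using cpt by (metis compact_Int_closed inf.absorb_iff2)
  have closed_end: "closedin (top_of_set K) (K \<inter> S \<times> {c})" for c :: real
    using S by (intro closedin_closed_Int closed_Times) (auto simp: compact_imp_closed)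
  have "\<exists>C. C \<subseteq> K \<and> connected C \<and> C \<inter> S \<times> {0} \<noteq> {} \<and> C \<inter> S \<times> {1} \<noteq> {}"
  proof (rule ccontr)
    assume no: "\<not> ?thesis"
    \<comment> \<open>In a compact Hausdorff space, two closed sets that no connected set joins lie
      in complementary clopen sets.\<close>
    have "separated_between (top_of_set K) (K \<inter> S \<times> {0}) (K \<inter> S \<times> {1})"
    proof (rule cut_wire_fence_theorem)
      show "compact_space (top_of_set K)"
        using \<open>compact K\<close> by (simp add: compact_space_subtopology)
      show "Hausdorff_space (top_of_set K)"
        by (simp add: Hausdorff_space_subtopology)
      show "disjnt C (K \<inter> S \<times> {0}) \<or> disjnt C (K \<inter> S \<times> {1})"
        if "connectedin (top_of_set K) C" for C
        using that no by (auto simp: connectedin_subtopology disjnt_def)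
    qed (rule closed_end)+
    then obtain A where A: "closedin (top_of_set K) A" "openin (top_of_set K) A"
      "K \<inter> S \<times> {0} \<subseteq> A" "K \<inter> S \<times> {1} \<subseteq> K - A"
      by (auto simp: separated_between)
    have "closed A" "closed (K - A)"
      using A \<open>closed K\<close> closedin_diff[OF closedin_topspace, of "top_of_set K" A]
      by (auto intro: closedin_closed_trans)
    \<comment> \<open>The values are crossed: \<open>u\<close> is 1 on the part containing the end
      at 0 and 0 on the part containing the end at 1. So \<open>u p = snd p\<close> sends a point of
      either part to the end that lies in the other one.\<close>
    then obtain u :: "'a \<times> real \<Rightarrow> real" where u: "continuous_on UNIV u"
      "\<And>p. u p \<in> closed_segment 1 0" "\<And>p. p \<in> A \<Longrightarrow> u p = 1" "\<And>p. p \<in> K - A \<Longrightarrow> u p = 0"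
      by (rule Urysohn[where a = 1 and b = 0]) auto
    have u01: "u p \<in> {0..1}" for p
      using u(2)[of p] by (simp add: closed_segment_eq_real_ivl)
    obtain p where p: "p \<in> S \<times> {0..1}" "(F p, u p) = p"
    proof (rule brouwer[OF cpt])
      show "continuous_on (S \<times> {0..1}) (\<lambda>p. (F p, u p))"
        by (intro continuous_on_Pair contF continuous_on_subset[OF u(1)]) auto
    qed (use S F u01 in \<open>auto intro!: convex_Times\<close>)
    then have "F p = fst p" "u p = snd p"
      by (metis fst_conv, metis snd_conv)
    with p have pK: "p \<in> K"
      by (simp add: K_def)
    show False
    proof (cases "p \<in> A")
      case True
      then have "snd p = 1" using u \<open>u p = snd p\<close> by simp
      then have "p \<in> K \<inter> S \<times> {1}" using pK p by (auto simp: mem_Times_iff)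
      then show False using A True by blast
    next
      case False
      then have "snd p = 0" using u pK \<open>u p = snd p\<close> by simp
      then have "p \<in> K \<inter> S \<times> {0}" using pK p by (auto simp: mem_Times_iff)
      then show False using A False by blast
    qed
  qed
  then show thesis
    using that K_def by blast
qed

text \<open>Projecting onto \<open>S\<close> makes \<open>x - h x t\<close> a self-map of
  \<open>S\<close>; the sign condition rules out fixed points that the projection alone would create
  on the boundary.\<close>

theorem connected_zeros_homotopy:
  fixes h :: "'a::euclidean_space \<Rightarrow> real \<Rightarrow> 'a"
  assumes S: "compact S" "convex S" and x0: "x0 \<in> S"
    and cont: "continuous_on (S \<times> {0..1}) (\<lambda>(x, t). h x t)"
    and pos: "\<And>x t. \<lbrakk>x \<in> S; x \<notin> interior S; t \<in> {0..1}\<rbrakk> \<Longrightarrow> (x - x0) \<bullet> h x t > 0"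
  obtains C where "C \<subseteq> {(x, t) \<in> S \<times> {0..1}. h x t = 0}" "connected C"
    "C \<inter> S \<times> {0} \<noteq> {}" "C \<inter> S \<times> {1} \<noteq> {}"
proof -
  define F where "F = (\<lambda>p. closest_point S (fst p - (\<lambda>(x, t). h x t) p))"
  have "closed S" "S \<noteq> {}"
    using S x0 by (auto simp: compact_imp_closed)
  have "continuous_on (S \<times> {0..1}) F"
    unfolding F_def
    by (rule continuous_on_compose2[OF continuous_on_closest_point[of S UNIV]])
      (use S \<open>closed S\<close> \<open>S \<noteq> {}\<close> in \<open>auto intro!: cont continuous_intros\<close>)
  moreover have "F \<in> S \<times> {0..1} \<rightarrow> S"
    using \<open>closed S\<close> \<open>S \<noteq> {}\<close> by (auto simp: F_def closest_point_in_set)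
  ultimately obtain C where C: "C \<subseteq> {p \<in> S \<times> {0..1}. F p = fst p}" "connected C"
    "C \<inter> S \<times> {0} \<noteq> {}" "C \<inter> S \<times> {1} \<noteq> {}"
    by (rule connected_fixed_points_homotopy[OF S \<open>S \<noteq> {}\<close>])
  have zero: "h x t = 0" if x: "x \<in> S" and t: "t \<in> {0..1}" and eq: "F (x, t) = x" for x t
  proof -
    \<comment> \<open>This is the variational inequality for \<open>x\<close> as the point of
      \<open>S\<close> closest to \<open>x - h x t\<close>.\<close>
    have *: "h x t \<bullet> (x - y) \<le> 0" if "y \<in> S" for y
      using closest_point_dot[OF S(2) \<open>closed S\<close> that, of "x - h x t"] eq
      by (simp add: F_def inner_diff_right)
    \<comment> \<open>On the boundary, \<open>pos\<close> would contradict the inequality for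
      \<open>y = x0\<close>.\<close>
    have "x \<in> interior S"
      using pos[OF x _ t] *[OF x0] by (force simp: inner_commute)
    then obtain e where e: "e > 0" "cball x e \<subseteq> S"
      by (auto simp: mem_interior_cball)
    show ?thesis
    proof (rule ccontr)
      assume nz: "h x t \<noteq> 0"
      \<comment> \<open>A step of length \<open>e\<close> from \<open>x\<close> against
        \<open>h x t\<close> stays in \<open>S\<close>; there the inequality reads
        \<open>e * norm (h x t) \<le> 0\<close>.\<close>
      define y where "y = x - (e / norm (h x t)) *\<^sub>R h x t"
      have "y \<in> cball x e"
        using e nz by (simp add: y_def dist_norm)
      then have "(e / norm (h x t)) * (h x t \<bullet> h x t) \<le> 0"
        using *[of y] e(2) by (simp add: y_def subset_iff)
      moreover have "(e / norm (h x t)) * (h x t \<bullet> h x t) > 0"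
        using nz e by (intro mult_pos_pos) auto
      ultimately show False
        by linarith
    qed
  qed
  show thesis
    using C zero by (intro that[of C]) auto
qed

section \<open>Continuity of the multilevel map\<close>

lemma continuously_differentiable_imp_continuous_on:
  "continuously_differentiable g \<Longrightarrow> continuous_on A g"
  unfolding continuously_differentiable_def
  by (meson continuous_at_imp_continuous_on has_derivative_continuous)

lemma continuous_on_level_avg:
  assumes "\<And>i. i \<in> {1..q l} \<Longrightarrow> continuous_on A (\<lambda>x. f x (\<xi> i))"
  shows "continuous_on A (level_avg f \<xi> q l)"
  unfolding level_avg_def using assms by (cases "l = 0") (auto intro!: continuous_intros)

lemma continuous_on_level_map:
  assumes "continuous_on A (level_avg f \<xi> q (l - 1))" "continuous_on A (level_avg f \<xi> q l)"
  shows "continuous_on (A \<times> T) (\<lambda>(x, t). level_map f \<xi> q \<tau> l x t)"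
proof -
  \<comment> \<open>\<open>\<tau> l - \<tau> (l - 1)\<close> is a constant, so multiplying by its inverse is continuous even if it is 0.\<close>
  have "continuous_on (A \<times> T) (\<lambda>p. level_weight \<tau> l (snd p))"
    unfolding level_weight_def divide_inverse by (intro continuous_intros)
  moreover have "continuous_on (A \<times> T) (\<lambda>p. level_avg f \<xi> q k (fst p))"
    if "continuous_on A (level_avg f \<xi> q k)" for k
    by (rule continuous_on_compose2[OF that]) (auto intro!: continuous_intros)
  ultimately show ?thesis
    unfolding level_map_def case_prod_beta using assms by (intro continuous_intros) auto
qed

lemma knot_interval_exists:
  fixes \<tau> :: "nat \<Rightarrow> real"
  assumes "\<tau> L \<le> t" "t \<le> \<tau> 0" "1 \<le> L"
  obtains l where "l \<in> {1..L}" "t \<in> {\<tau> l..\<tau> (l - 1)}"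
proof -
  \<comment> \<open>Minimality puts the preceding knot above \<open>t\<close>; for
    \<open>l = 1\<close> the assumption \<open>t \<le> \<tau> 0\<close> takes its place.\<close>
  define l where "l = (LEAST l. 1 \<le> l \<and> \<tau> l \<le> t)"
  have l: "1 \<le> l" "\<tau> l \<le> t"
    using LeastI[of "\<lambda>l. 1 \<le> l \<and> \<tau> l \<le> t" L] assms unfolding l_def by auto
  have "l \<le> L"
    unfolding l_def using assms by (intro Least_le) auto
  have "t \<le> \<tau> (l - 1)"
  proof (cases "l = 1")
    case False
    then show ?thesis
      using not_less_Least[of "l - 1" "\<lambda>l. 1 \<le> l \<and> \<tau> l \<le> t"] l unfolding l_def[symmetric] by auto
  qed (use assms in simp)
  with l \<open>l \<le> L\<close> show thesis
    by (intro that) auto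
qed

text \<open>On each of finitely many closed strips the map is a single \<open>level_map\<close>, so
  continuity follows by pasting.\<close>

lemma continuous_on_multilevel_map:
  assumes anti: "strict_antimono_on {0..L} \<tau>" and L: "1 \<le> L" and A: "closed A"
    and cont: "\<And>l. l \<le> L \<Longrightarrow> continuous_on A (level_avg f \<xi> q l)"
  shows "continuous_on (A \<times> {\<tau> L..\<tau> 0}) (\<lambda>(x, t). multilevel_map f \<xi> q \<tau> L x t)"
proof -
  have "continuous_on (\<Union>l\<in>{1..L}. A \<times> {\<tau> l..\<tau> (l - 1)}) (\<lambda>(x, t). multilevel_map f \<xi> q \<tau> L x t)"
  proof (rule continuous_on_closed_Union)
    fix l assume l: "l \<in> {1..L}"
    show "continuous_on (A \<times> {\<tau> l..\<tau> (l - 1)}) (\<lambda>(x, t). multilevel_map f \<xi> q \<tau> L x t)"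
    proof (rule continuous_on_eq)
      show "continuous_on (A \<times> {\<tau> l..\<tau> (l - 1)}) (\<lambda>(x, t). level_map f \<xi> q \<tau> l x t)"
        using cont l by (intro continuous_on_level_map) auto
    qed (auto simp: multilevel_map_eq[OF anti l])
  qed (use A in \<open>auto intro: closed_Times\<close>)
  moreover have "A \<times> {\<tau> L..\<tau> 0} \<subseteq> (\<Union>l\<in>{1..L}. A \<times> {\<tau> l..\<tau> (l - 1)})"
  proof
    fix p assume "p \<in> A \<times> {\<tau> L..\<tau> 0}"
    then obtain l where "l \<in> {1..L}" "snd p \<in> {\<tau> l..\<tau> (l - 1)}" "fst p \<in> A"
      using knot_interval_exists[of \<tau> L "snd p"] L by (metis atLeastAtMost_iff mem_Times_iff)
    then show "p \<in> (\<Union>l\<in>{1..L}. A \<times> {\<tau> l..\<tau> (l - 1)})"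
      by (intro UN_I) (auto simp: mem_Times_iff)
  qed
  ultimately show ?thesis
    by (rule continuous_on_subset)
qed

section \<open>Positivity of the multilevel map\<close>

lemma inner_level_avg_pos:
  assumes "0 < l" "0 < q l" and "\<And>i. i \<in> {1..q l} \<Longrightarrow> v \<bullet> f x (\<xi> i) > 0"
  shows "v \<bullet> level_avg f \<xi> q l x > 0"
  using assms by (auto simp: level_avg_def inner_sum_right intro!: sum_pos divide_pos_pos)

lemma level_weight_bounds: "0 \<le> level_weight \<tau> l t" "level_weight \<tau> l t \<le> 1"
  by (simp_all add: level_weight_def abs_square_le_1)

text \<open>The argument of the sine grows from 0 at the excluded endpoint
  \<open>\<tau> (l - 1)\<close> to \<open>pi / 2\<close> at \<open>\<tau> l\<close>.\<close>

lemma level_weight_pos: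
  assumes "\<tau> l \<le> t" "t < \<tau> (l - 1)"
  shows "0 < level_weight \<tau> l t"
proof -
  define s where "s = (t - \<tau> (l - 1)) / (\<tau> l - \<tau> (l - 1))"
  have "0 < s" "s \<le> 1"
    using assms by (auto simp: s_def divide_simps)
  then have "0 < s * (pi / 2)" "s * (pi / 2) < pi"
    using mult_right_mono[of s 1 "pi / 2"] pi_gt_zero by (auto simp del: pi_gt_zero)
  then have "0 < sin (s * (pi / 2))"
    by (rule sin_gt_zero)
  then show ?thesis
    by (simp add: level_weight_def s_def)
qed

text \<open>The inner product is a convex combination of its values at two neighbouring levels. Only
  level 0 contributes 0 instead of a positive number, and it carries the full weight only at
  \<open>t = \<tau> 0\<close>.\<close>

lemma inner_multilevel_map:
  assumes anti: "strict_antimono_on {0..L} \<tau>" and L: "1 \<le> L" and t: "\<tau> L \<le> t" "t \<le> \<tau> 0"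
    and pos: "\<And>l. l \<in> {1..L} \<Longrightarrow> v \<bullet> level_avg f \<xi> q l x > 0"
  shows "v \<bullet> multilevel_map f \<xi> q \<tau> L x t \<ge> 0"
    and "t < \<tau> 0 \<Longrightarrow> v \<bullet> multilevel_map f \<xi> q \<tau> L x t > 0"
proof -
  obtain l where l: "l \<in> {1..L}" "t \<in> {\<tau> l..\<tau> (l - 1)}"
    using knot_interval_exists t L by blast
  define w where "w = level_weight \<tau> l t"
  have w: "0 \<le> w" "w \<le> 1"
    by (simp_all add: w_def level_weight_bounds)
  define a b where "a = v \<bullet> level_avg f \<xi> q (l - 1) x" and "b = v \<bullet> level_avg f \<xi> q l x"
  have eq: "v \<bullet> multilevel_map f \<xi> q \<tau> L x t = (1 - w) * a + w * b"
    by (simp add: multilevel_map_eq[OF anti l] level_map_def w_def a_def b_def inner_add_right)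
  have "b > 0"
    unfolding b_def using pos l by blast
  \<comment> \<open>For \<open>l = 1\<close> the lower level is the zero map, so
    \<open>a = 0\<close>.\<close>
  have a: "a \<ge> 0" "l \<noteq> 1 \<Longrightarrow> a > 0"
    using pos[of "l - 1"] l by (cases "l = 1"; fastforce simp: a_def level_avg_def)+
  show "v \<bullet> multilevel_map f \<xi> q \<tau> L x t \<ge> 0"
    unfolding eq using w a \<open>b > 0\<close> by simp
  assume "t < \<tau> 0"
  show "v \<bullet> multilevel_map f \<xi> q \<tau> L x t > 0"
  \<comment> \<open>The weight vanishes only at \<open>t = \<tau> (l - 1)\<close>, which for
    \<open>l = 1\<close> is the excluded \<open>\<tau> 0\<close>.\<close>
  proof (cases "w = 0")
    case True
    then have "l \<noteq> 1"
      using level_weight_pos[of \<tau> l t] l \<open>t < \<tau> 0\<close> by (auto simp: w_def)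
    then show ?thesis
      unfolding eq using True a by simp
  next
    case False
    then show ?thesis
      unfolding eq using w a \<open>b > 0\<close> by (intro add_nonneg_pos) auto
  qed
qed

section \<open>Application to the sampled homotopy\<close>

theorem corollary2:
  fixes \<Omega> :: "'w set"
    and f :: "real^'n \<Rightarrow> 'w \<Rightarrow> real^'n"
    and \<xi> :: "nat \<Rightarrow> 'w"
    and q :: "nat \<Rightarrow> nat"
    and \<tau> :: "nat \<Rightarrow> real"
    and L N :: nat
    and X :: "(real^'n) set"
    and x0 :: "real^'n"
  assumes C1: "\<forall>\<omega>\<in>\<Omega>. continuously_differentiable (\<lambda>x. f x \<omega>)"
    and N: "N \<ge> 1"
    and samples: "\<forall>i\<in>{1..N}. \<xi> i \<in> \<Omega>"
    and L: "1 \<le> L" "L \<le> N"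
    and q: "0 < q 1" "strict_mono_on {1..L} q" "q L = N"
    and \<tau>: "\<tau> 0 = 1" "strict_antimono_on {0..L} \<tau>" "\<tau> L = 0"
    and X: "compact X" "convex X" "interior X \<noteq> {}"
    and pos: "\<forall>\<omega>\<in>\<Omega>. \<forall>x. x \<notin> interior X \<longrightarrow> (\<forall>y\<in>interior X. (x - y) \<bullet> f x \<omega> > 0)"
    and x0: "x0 \<in> interior X"
  defines "d \<equiv> multilevel_map f \<xi> q \<tau> L"
  defines "h \<equiv> homotopy_map d x0"
  shows "\<exists>Hc. Hc \<subseteq> homotopy_zeros h \<and> connected Hc \<and>
           (X \<times> {0}) \<inter> Hc \<noteq> {} \<and> (X \<times> {1}) \<inter> Hc \<noteq> {}"
proof -
  \<comment> \<open>Every average is thus over a nonempty set of indices from \<open>{1..N}\<close>,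
    whose samples lie in \<open>\<Omega>\<close>.\<close>
  have ql: "0 < q l" "q l \<le> N" if "l \<in> {1..L}" for l
  proof -
    have mono: "q i \<le> q j" if "i \<le> j" "i \<in> {1..L}" "j \<in> {1..L}" for i j
      using monotone_onD[OF q(2), of i j] that by (cases "i = j") auto
    show "0 < q l" "q l \<le> N"
      using mono[of 1 l] mono[of l L] that q L by auto
  qed
  then have sample: "\<xi> i \<in> \<Omega>" if "l \<in> {1..L}" "i \<in> {1..q l}" for l i
    using samples that by (meson atLeastAtMost_iff le_trans)
  have "continuous_on X (level_avg f \<xi> q l)" if "l \<le> L" for l
  proof (cases "l = 0")
    case True
    then show ?thesis by (simp add: level_avg_def)
  next
    case False
    with that have "l \<in> {1..L}" by simp
    then show ?thesis
      by (intro continuous_on_level_avg continuously_differentiable_imp_continuous_on)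
        (use C1 sample in blast)
  qed
  then have "continuous_on (X \<times> {\<tau> L..\<tau> 0}) (\<lambda>(x, t). d x t)"
    unfolding d_def using \<tau> L X by (intro continuous_on_multilevel_map) (auto simp: compact_imp_closed)
  then have cont: "continuous_on (X \<times> {0..1}) (\<lambda>(x, t). h x t)"
    unfolding h_def homotopy_map_def case_prod_beta \<tau> by (intro continuous_intros)
  have pos_h: "(x - x0) \<bullet> h x t > 0" if x: "x \<notin> interior X" and t: "t \<in> {0..1}" for x t
  proof -
    have "(x - x0) \<bullet> level_avg f \<xi> q l x > 0" if "l \<in> {1..L}" for l
      using that ql pos x x0 sample by (intro inner_level_avg_pos) auto
    then have d: "(x - x0) \<bullet> d x t \<ge> 0" "t < 1 \<Longrightarrow> (x - x0) \<bullet> d x t > 0"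
      unfolding d_def using inner_multilevel_map[OF \<tau>(2) L(1), of t "x - x0" f \<xi> q x] t \<tau> by auto
    have eq: "(x - x0) \<bullet> h x t = (1 - t) * ((x - x0) \<bullet> d x t) + t * ((x - x0) \<bullet> (x - x0))"
      by (simp add: h_def homotopy_map_def inner_add_right)
    show ?thesis
    \<comment> \<open>At \<open>t = 1\<close> only \<open>x - x0\<close> remains, which is nonzero
      because \<open>x0\<close> is interior and \<open>x\<close> is not. For \<open>t < 1\<close>
      the term with \<open>d\<close> is already strictly positive.\<close>
    proof (cases "t = 1")
      case True
      then show ?thesis
        using x x0 unfolding eq by auto
    next
      case False
      then show ?thesis
        using d t unfolding eq by (intro add_pos_nonneg) auto
    qed
  qed
  have "x0 \<in> X"
    using x0 interior_subset by blast
  then obtain C where "C \<subseteq> {(x, t) \<in> X \<times> {0..1}. h x t = 0}" "connected C"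
    "C \<inter> X \<times> {0} \<noteq> {}" "C \<inter> X \<times> {1} \<noteq> {}"
    using connected_zeros_homotopy[OF X(1,2) \<open>x0 \<in> X\<close> cont pos_h] by blast
  then show ?thesis
    by (intro exI[of _ C]) (auto simp: homotopy_zeros_def)
qed

end
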